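(* A slack matrix of a convex heptagon (convex polygon with $7$ vertices in $\mathbb{R}^2$) has nonnegative rank at most $6$.
   Context: Let a polytope $P$ with vertices $p_1,\dots,p_v$ and $f$ facets be given as the set of $x$ with $c_i(x)\geq\beta_i$ for $i=1,\dots,f$ (one inequality per facet) and $c_j(x)=\beta_j$ for $j=f+1,\dots,q$, where $c_1,\dots,c_q$ are linear functionals. A slack matrix of $P$ is the $f$-by-$v$ matrix $S$ with $S_{it}=c_i(p_t)-\beta_i$. The nonnegative rank of a nonnegative matrix $A\in\mathbb{R}_+^{m\times n}$ is the smallest $k$ such that $A=BC$ with $B\in\mathbb{R}_+^{m\times k}$, $C\in\mathbb{R}_+^{k\times n}$. *)

theory Defs
  imports "HOL-Analysis.Analysis" "Jordan_Normal_Form.Matrix"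
begin

definition convex_heptagon :: "(real ^ 2) set \<Rightarrow> bool" where
  "convex_heptagon P \<longleftrightarrow>
     polytope P \<and> aff_dim P = 2 \<and> card {x. x extreme_point_of P} = 7"

(* The vertices p and the inequalities c i x \<ge> \<beta> i (i < f) are enumerated in an arbitrary
   order; the indices f \<le> j < q, possibly none, belong to the equations.  Indices start at 0. *)
definition slack_matrix_of :: "real mat \<Rightarrow> 'a::euclidean_space set \<Rightarrow> bool" where
  "slack_matrix_of S P \<longleftrightarrow>
     polytope P \<and>
     (\<exists>(v::nat) (f::nat) (q::nat) (p :: nat \<Rightarrow> 'a) (c :: nat \<Rightarrow> 'a \<Rightarrow> real) (\<beta> :: nat \<Rightarrow> real).
        f \<le> q \<and>
        (\<forall>i<q. linear (c i)) \<and>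
        P = {x. (\<forall>i<f. c i x \<ge> \<beta> i) \<and> (\<forall>j. f \<le> j \<and> j < q \<longrightarrow> c j x = \<beta> j)} \<and>
        bij_betw (\<lambda>i. {x \<in> P. c i x = \<beta> i}) {..<f} {F. F facet_of P} \<and>
        bij_betw p {..<v} {x. x extreme_point_of P} \<and>
        S = Matrix.mat f v (\<lambda>(i, t). c i (p t) - \<beta> i))"

definition nonneg_mat :: "real mat \<Rightarrow> bool" where
  "nonneg_mat A \<longleftrightarrow> (\<forall>i<dim_row A. \<forall>j<dim_col A. A $$ (i, j) \<ge> 0)"

definition nonneg_factorization :: "real mat \<Rightarrow> nat \<Rightarrow> bool" where
  "nonneg_factorization A k \<longleftrightarrow>
     (\<exists>B C. B \<in> carrier_mat (dim_row A) k \<and> C \<in> carrier_mat k (dim_col A) \<and>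
            nonneg_mat B \<and> nonneg_mat C \<and> A = B * C)"

(* Meaningful for nonnegative A only: otherwise there is no k and LEAST is unspecified. *)
definition nonneg_rank :: "real mat \<Rightarrow> nat" where
  "nonneg_rank A = (LEAST k. nonneg_factorization A k)"

lemma nonneg_factorization_exists:
  assumes "nonneg_mat A"
  shows "nonneg_factorization A (dim_col A)"
  unfolding nonneg_factorization_def
proof (intro exI conjI)
  show "A \<in> carrier_mat (dim_row A) (dim_col A)" by simp
  show "1\<^sub>m (dim_col A) \<in> carrier_mat (dim_col A) (dim_col A)" by simp
  show "nonneg_mat A" by (fact assms)
  show "nonneg_mat (1\<^sub>m (dim_col A))" by (simp add: nonneg_mat_def)
  show "A = A * 1\<^sub>m (dim_col A)" by (simp add: right_mult_one_mat')
qed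

lemma slack_matrix_of_nonneg:
  assumes "slack_matrix_of S P"
  shows "nonneg_mat S"
proof -
  obtain v f q p c \<beta> where
      P: "P = {x. (\<forall>i<f. c i x \<ge> \<beta> i) \<and> (\<forall>j. f \<le> j \<and> j < q \<longrightarrow> c j x = \<beta> j)}"
    and p: "bij_betw p {..<v} {x. x extreme_point_of P}"
    and S: "S = Matrix.mat f v (\<lambda>(i, t). c i (p t) - \<beta> i)"
    using assms unfolding slack_matrix_of_def by (elim conjE exE)
  have pP: "p t \<in> P" if "t < v" for t
    using bij_betwE[OF p] that by (auto simp: extreme_point_of_def)
  have "c i (p t) \<ge> \<beta> i" if "i < f" "t < v" for i t
    using pP[OF that(2)] that(1) P by blast
  then show ?thesis
    by (auto simp: S nonneg_mat_def)
qed

end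

theory Submission
  imports Defs
begin

text \<open>
  Write \<open>z0, \<dots>, z6\<close> for the vertices in cyclic order, lifted to \<open>\<real>\<^sup>3\<close> by a last coordinate \<open>1\<close>.
  The factorization comes from presenting the heptagon as a plane section of the convex hull of three
  points above and three points below the plane: if \<open>a1, a2, a3, b1, b2, b3 \<in> \<real>\<^sup>3\<close> are such that
  all nine sums \<open>ai + bj\<close> lie in the cone over the heptagon and every \<open>zk\<close> is a positive multiple
  of one of them, then a functional \<open>l\<close> nonnegative on the heptagon has \<open>l ai + l bj \<ge> 0\<close>, so
  \<open>l ai - m\<close> and \<open>l bj + m\<close> are nonnegative for \<open>m = min l ai\<close>, and the six of them express all \<open>l zk\<close>.

  Such points are forced by the linear relations within the quadruples \<open>z0, z1, z2, z3\<close> and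
  \<open>z4, z5, z6, z0\<close>: they turn seven of the sums into multiples of vertices, and the remaining two lie in
  the cone if two inequalities between products of triangle areas hold.  If these inequalities failed for
  every choice of the starting vertex, one of them would fail for all seven choices, and multiplying the
  seven failures together contradicts the three-term Pluecker relations.
\<close>

section \<open>Nonnegative factorizations from sums of two families\<close>

text \<open>Moving the minimum of \<open>x i\<close> over to \<open>y i\<close> keeps every sum and
  makes both blocks of \<open>B\<close> nonnegative; column \<open>t\<close> of \<open>C\<close>
  picks one column of each block, with weight \<open>w t\<close>.\<close>

lemma nonneg_factorization_of_sum_grid:
  fixes S :: "real mat" and x y :: "nat \<Rightarrow> nat \<Rightarrow> real"
  assumes "k > 0"
    and nonneg: "\<And>i r s. \<lbrakk>i < dim_row S; r < k; s < l\<rbrakk> \<Longrightarrow> x i r + y i s \<ge> 0"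
    and entries: "\<And>t. t < dim_col S \<Longrightarrow> \<exists>r<k. \<exists>s<l. \<exists>w\<ge>0. \<forall>i<dim_row S. S $$ (i, t) = w * (x i r + y i s)"
  shows "nonneg_factorization S (k + l)"
proof -
  have "\<forall>t. \<exists>r s w. t < dim_col S \<longrightarrow> r < k \<and> s < l \<and> w \<ge> 0 \<and>
      (\<forall>i<dim_row S. S $$ (i, t) = w * (x i r + y i s))"
    using entries by meson
  then obtain r s w where rsw: "\<And>t. t < dim_col S \<Longrightarrow> r t < k \<and> s t < l \<and> w t \<ge> (0::real) \<and>
      (\<forall>i<dim_row S. S $$ (i, t) = w t * (x i (r t) + y i (s t)))"
    by metis
  define \<mu> where "\<mu> i = Min (x i ` {..<k})" for i
  have \<mu>_le: "\<mu> i \<le> x i r" if "r < k" for i r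
    using that by (simp add: \<mu>_def)
  have \<mu>_ge: "y i s + \<mu> i \<ge> 0" if "i < dim_row S" "s < l" for i s
  proof -
    have "\<mu> i \<in> x i ` {..<k}"
      unfolding \<mu>_def using \<open>k > 0\<close> by (intro Min_in) auto
    then obtain r where "r < k" "\<mu> i = x i r" by auto
    then show ?thesis using nonneg[OF that(1) \<open>r < k\<close> that(2)] by simp
  qed
  define B where "B = Matrix.mat (dim_row S) (k + l)
    (\<lambda>(i, j). if j < k then x i j - \<mu> i else y i (j - k) + \<mu> i)"
  define C where "C = Matrix.mat (k + l) (dim_col S)
    (\<lambda>(j, t). if j = r t \<or> j = k + s t then w t else 0)"
  have "nonneg_mat B"
    unfolding nonneg_mat_def B_def using \<mu>_le \<mu>_ge by auto
  moreover have "nonneg_mat C"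
    unfolding nonneg_mat_def C_def using rsw by auto
  moreover have "S = B * C"
  proof (rule eq_matI)
    fix i t assume "i < dim_row (B * C)" "t < dim_col (B * C)"
    then have it: "i < dim_row S" "t < dim_col S" by (auto simp: B_def C_def)
    note rt = rsw[OF it(2)]
    have "(B * C) $$ (i, t) = (\<Sum>j\<in>{0..<k + l}. B $$ (i, j) * C $$ (j, t))"
      using it by (simp add: B_def C_def scalar_prod_def)
    also have "\<dots> = (\<Sum>j\<in>{r t, k + s t}. B $$ (i, j) * C $$ (j, t))"
      using rt it by (intro sum.mono_neutral_right) (auto simp: C_def)
    also have "\<dots> = w t * (x i (r t) + y i (s t))"
      using rt it by (auto simp: B_def C_def algebra_simps)
    finally show "S $$ (i, t) = (B * C) $$ (i, t)" using rt it by simp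
  qed (auto simp: B_def C_def)
  moreover have "B \<in> carrier_mat (dim_row S) (k + l)" "C \<in> carrier_mat (k + l) (dim_col S)"
    by (simp_all add: B_def C_def)
  ultimately show ?thesis
    unfolding nonneg_factorization_def by blast
qed

section \<open>Signed areas and Pluecker relations\<close>

text \<open>Twice the signed area, positive for counterclockwise triples; equivalently the
  determinant of the three points lifted by a coordinate 1.\<close>

definition tri :: "real ^ 2 \<Rightarrow> real ^ 2 \<Rightarrow> real ^ 2 \<Rightarrow> real" where
  "tri a b c = (vec_nth b 1 - vec_nth a 1) * (vec_nth c 2 - vec_nth a 2)
             - (vec_nth b 2 - vec_nth a 2) * (vec_nth c 1 - vec_nth a 1)"

lemma tri_rotate: "tri b c a = tri a b c" "tri c a b = tri a b c"
  by (simp_all add: tri_def algebra_simps)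

text \<open>With \<open>z\<close> as origin, this is the relation among the 2x2 minors of a 2x4
  matrix.\<close>

lemma tri_pluecker:
  "tri z a c * tri z b d = tri z a b * tri z c d + tri z a d * tri z b c"
  by (simp add: tri_def algebra_simps)

text \<open>Cramer's rule for the linear dependence of four lifted points; \<open>tri_sum\<close> is
  its last coordinate.\<close>

lemma tri_linear_relation:
  "tri b c d *\<^sub>R a + tri a b d *\<^sub>R c = tri a c d *\<^sub>R b + tri a b c *\<^sub>R d"
  by (simp add: Finite_Cartesian_Product.vec_eq_iff forall_2 tri_def algebra_simps)

lemma tri_sum: "tri b c d + tri a b d = tri a c d + tri a b c"
  by (simp add: tri_def algebra_simps)

lemma tri_affine_relation:
  fixes c :: "real ^ 2 \<Rightarrow> real"
  assumes "linear c"
  shows "tri y z w * (c x - \<beta>) + tri x y w * (c z - \<beta>)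
       = tri x z w * (c y - \<beta>) + tri x y z * (c w - \<beta>)"
proof -
  have "tri y z w * c x + tri x y w * c z = tri x z w * c y + tri x y z * c w"
    using arg_cong[OF tri_linear_relation[of y z w x], of c]
    by (simp add: linear_add[OF assms] linear_scale[OF assms])
  moreover have "tri y z w * \<beta> + tri x y w * \<beta> = tri x z w * \<beta> + tri x y z * \<beta>"
    using tri_sum[of y z w x] by (metis distrib_right)
  ultimately show ?thesis by (simp add: algebra_simps)
qed

section \<open>Convex position in cyclic order\<close>

text \<open>Indices run over all naturals with period \<open>n\<close>, so that a change of the
  starting vertex is a mere shift; \<open>k < i + n\<close> keeps a triple within one turn.\<close>

definition convex_cycle :: "nat \<Rightarrow> (nat \<Rightarrow> real ^ 2) \<Rightarrow> bool" where
  "convex_cycle n q \<longleftrightarrow> (\<forall>i. q (i + n) = q i) \<and>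
     (\<forall>i j k. i < j \<and> j < k \<and> k < i + n \<longrightarrow> tri (q i) (q j) (q k) > 0)"

lemma convex_cycle_shift:
  assumes "convex_cycle n q"
  shows "convex_cycle n (\<lambda>i. q (i + s))"
  using assms unfolding convex_cycle_def
  by (smt (verit) ab_semigroup_add_class.add_ac(1) add.commute add_less_cancel_right)

lemma convex_cycle_shift_surj:
  assumes "convex_cycle n q" "n > 0"
  shows "\<exists>j<n. q k = q (j + s)"
proof -
  have per: "q (i + n * m) = q i" for i m
  proof (induction m)
    case (Suc m)
    have "q (i + n * Suc m) = q ((i + n * m) + n)" by (simp add: algebra_simps)
    with Suc show ?case using assms(1) by (simp add: convex_cycle_def)
  qed simp
  \<comment> \<open>\<open>(n - 1) * s\<close> serves as \<open>- s\<close> modulo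
    \<open>n\<close>.\<close>
  let ?m = "k + (n - 1) * s"
  have "k + n * s = ?m + s"
    using \<open>n > 0\<close> by (cases n) simp_all
  also have "\<dots> = ?m mod n + s + n * (?m div n)"
    using div_mult_mod_eq[of ?m n] by (simp add: mult.commute)
  finally have "k + n * s = ?m mod n + s + n * (?m div n)" .
  then have "q k = q (?m mod n + s)"
    using per by metis
  then show ?thesis using \<open>n > 0\<close> by (intro exI[of _ "?m mod n"]) simp
qed

section \<open>Cyclic order of the vertices of a polygon\<close>

lemma bij_betw_strict_mono_key:
  fixes key :: "'a \<Rightarrow> 'b::linorder"
  assumes "finite W" "inj_on key W"
  obtains r where "bij_betw r {..<card W} W"
    and "\<And>i j. \<lbrakk>i < j; j < card W\<rbrakk> \<Longrightarrow> key (r i) < key (r j)"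
proof -
  define xs where "xs = sorted_list_of_set (key ` W)"
  have len: "length xs = card W"
    using assms by (simp add: xs_def card_image)
  have set: "set xs = key ` W" and "distinct xs" and srt: "sorted_wrt (<) xs"
    using assms by (simp_all add: xs_def)
  have "bij_betw (\<lambda>i. xs ! i) {..<card W} (key ` W)"
    using \<open>distinct xs\<close> by (intro bij_betw_nth) (simp_all add: len set)
  moreover have "bij_betw (inv_into W key) (key ` W) W"
    using assms(2) by (simp add: bij_betw_inv_into inj_on_imp_bij_betw)
  ultimately have bij: "bij_betw (inv_into W key \<circ> (\<lambda>i. xs ! i)) {..<card W} W"
    by (rule bij_betw_trans)
  have "key (inv_into W key (xs ! i)) = xs ! i" if "i < card W" for i
    using that set len by (metis f_inv_into_f nth_mem)
  then show ?thesis
    using sorted_wrt_nth_less[OF srt] len by (intro that[OF bij]) simp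
qed

text \<open>Deleting an extreme point leaves a convex set, which contains the hull of the other
  extreme points.\<close>

lemma extreme_point_not_in_hull_of_others:
  assumes "convex P" "x extreme_point_of P"
  shows "x \<notin> convex hull ({y. y extreme_point_of P} - {x})"
proof -
  have "convex (P - {x})"
    using assms extreme_point_of_stillconvex by blast
  then have "convex hull ({y. y extreme_point_of P} - {x}) \<subseteq> P - {x}"
    by (intro hull_minimal) (auto simp: extreme_point_of_def)
  then show ?thesis by blast
qed

text \<open>Modulo \<open>n\<close>, a triple within one turn is increasing up to rotation, and
  rotation preserves \<open>tri\<close>.\<close>

lemma convex_cycle_mod:
  assumes pos: "\<And>i j k. \<lbrakk>i < j; j < k; k < n\<rbrakk> \<Longrightarrow> tri (r i) (r j) (r k) > 0"
  shows "convex_cycle n (\<lambda>i. r (i mod n))"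
  unfolding convex_cycle_def
proof (intro conjI allI impI)
  fix i j k :: nat
  assume ijk: "i < j \<and> j < k \<and> k < i + n"
  define m where "m = i mod n"
  have m: "m < n" using ijk by (auto simp: m_def)
  have shift: "(i + d) mod n = (if m + d < n then m + d else m + d - n)" if "d < n" for d
  proof -
    have "(i + d) mod n = (m + d) mod n"
      by (simp add: m_def mod_add_left_eq)
    then show ?thesis
      using that m by (simp add: le_mod_geq)
  qed
  obtain d e where de: "j = i + d" "k = i + e"
    using ijk by (metis less_imp_add_positive less_trans)
  have "j mod n = (if m + d < n then m + d else m + d - n)"
    "k mod n = (if m + e < n then m + e else m + e - n)"
    using shift ijk de by auto
  then consider "m < j mod n" "j mod n < k mod n" | "k mod n < m" "m < j mod n" | "j mod n < k mod n" "k mod n < m"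
    using ijk de m by (auto split: if_splits)
  then show "tri (r (i mod n)) (r (j mod n)) (r (k mod n)) > 0"
  proof cases
    case 1
    then show ?thesis using pos[of m "j mod n" "k mod n"] ijk by (simp add: m_def)
  next
    case 2
    then show ?thesis using pos[of "k mod n" m "j mod n"] ijk by (simp add: m_def tri_rotate)
  next
    case 3
    then show ?thesis using pos[of "j mod n" "k mod n" m] m by (simp add: m_def tri_rotate)
  qed
qed simp

text \<open>Inner products with \<open>u\<close> and with \<open>u\<close> turned by a right angle
  serve as coordinates; the factor \<open>u \<bullet> u\<close> replaces normalizing
  \<open>u\<close>.\<close>

lemma tri_frame:
  fixes u v x y :: "real ^ 2"
  shows "(u \<bullet> u) * tri v x y = (u \<bullet> (x - v)) * tri 0 u (y - v) - tri 0 u (x - v) * (u \<bullet> (y - v))"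
  by (simp add: tri_def inner_vec_def sum_2 algebra_simps)

lemma frame_decomposition:
  fixes u w :: "real ^ 2"
  shows "(u \<bullet> u) *\<^sub>R w = (u \<bullet> w) *\<^sub>R u + tri 0 u w *\<^sub>R vector [- vec_nth u 2, vec_nth u 1]"
  by (simp add: Finite_Cartesian_Product.vec_eq_iff forall_2 tri_def inner_vec_def sum_2 algebra_simps)

text \<open>Seen from one vertex, the others lie in an open half-plane; sorted there by slope they
  are in convex position, since otherwise one would lie in the hull of the others.\<close>

lemma polytope_vertices_convex_cycle:
  fixes P :: "(real ^ 2) set"
  assumes P: "polytope P" and n: "card {x. x extreme_point_of P} = n" "n > 0"
  obtains q where "convex_cycle n q" "range q = {x. x extreme_point_of P}"
proof -
  define V where "V = {x. x extreme_point_of P}"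
  have finV: "finite V" and "V \<noteq> {}"
    using n by (auto simp: V_def[symmetric] card_gt_0_iff)
  then obtain v where v: "v \<in> V" by blast
  define W where "W = V - {v}"
  have hull: "x \<notin> convex hull (V - {x})" if "x \<in> V" for x
    using extreme_point_not_in_hull_of_others[of P x] that P polytope_imp_convex
    unfolding V_def by blast
  \<comment> \<open>A supporting line meeting \<open>P\<close> only in \<open>v\<close> makes
    \<open>G\<close> positive on \<open>W\<close>.\<close>
  have "{v} exposed_face_of P"
    using v by (simp add: V_def exposed_face_of_polyhedron[OF polytope_imp_polyhedron[OF P]] face_of_singleton)
  then obtain a b where "P \<subseteq> {x. a \<bullet> x \<le> b}" "{v} = P \<inter> {x. a \<bullet> x = b}"
    unfolding exposed_face_of_def by blast
  then have a: "a \<bullet> v = b" "\<And>x. x \<in> P \<Longrightarrow> x \<noteq> v \<Longrightarrow> a \<bullet> x < b"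
    by (auto simp: less_le)
  define u where "u = - a"
  \<comment> \<open>\<open>H / G\<close> is the slope of the ray from \<open>v\<close> in the frame \<open>u\<close>, \<open>u\<close> turned by a right angle;
    the other vertices are sorted by it.\<close>
  define G where "G x = u \<bullet> (x - v)" for x
  define H where "H x = tri 0 u (x - v)" for x
  have G: "G x > 0" if "x \<in> W" for x
    using a that by (auto simp: G_def u_def W_def V_def extreme_point_of_def inner_diff_right)
  have tri_v: "tri v x y > 0" if "x \<in> W" "y \<in> W" "H x / G x < H y / G y" for x y
  proof -
    have "(u \<bullet> u) * tri v x y = G x * H y - H x * G y"
      unfolding G_def H_def by (rule tri_frame)
    also have "\<dots> > 0"
      using that(3) G[OF that(1)] G[OF that(2)] by (simp add: field_simps)
    finally show ?thesis
      using inner_ge_zero[of u] by (auto simp: zero_less_mult_iff)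
  qed
  \<comment> \<open>Equal slopes put both vertices on one ray from \<open>v\<close>, so the nearer
    one would lie on the segment from \<open>v\<close> to the other.\<close>
  have inj': "x = y" if xy: "x \<in> W" "y \<in> W" "H x / G x = H y / G y" "G x \<le> G y" for x y
  proof (rule ccontr)
    assume "x \<noteq> y"
    define r where "r = G x / G y"
    have r: "0 \<le> r" "r \<le> 1" "G x = r * G y" "H x = r * H y"
      using xy G[OF xy(1)] G[OF xy(2)] by (auto simp: r_def field_simps)
    define J where "J = (vector [- vec_nth u 2, vec_nth u 1] :: real ^ 2)"
    have frame: "(u \<bullet> u) *\<^sub>R (z - v) = G z *\<^sub>R u + H z *\<^sub>R J" for z
      unfolding G_def H_def J_def by (rule frame_decomposition)
    have "(u \<bullet> u) *\<^sub>R (x - v) = r *\<^sub>R (G y *\<^sub>R u + H y *\<^sub>R J)"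
      unfolding frame r(3,4) by (simp add: scaleR_add_right)
    also have "\<dots> = (u \<bullet> u) *\<^sub>R (r *\<^sub>R (y - v))"
      unfolding frame[symmetric] by (simp only: scaleR_left_commute)
    finally have "(u \<bullet> u) *\<^sub>R (x - v) = (u \<bullet> u) *\<^sub>R (r *\<^sub>R (y - v))" .
    moreover have "u \<noteq> 0"
      using G[OF xy(1)] by (auto simp: G_def)
    ultimately have "x - v = r *\<^sub>R (y - v)"
      by (metis inner_eq_zero_iff real_vector.scale_left_imp_eq)
    then have "x = (1 - r) *\<^sub>R v + r *\<^sub>R y"
      by (simp add: algebra_simps)
    then have "x \<in> closed_segment v y"
      using r by (auto simp: in_segment)
    also have "\<dots> \<subseteq> convex hull (V - {x})"
      unfolding segment_convex_hull using xy v \<open>x \<noteq> y\<close> by (intro hull_mono) (auto simp: W_def)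
    finally show False using hull xy by (auto simp: W_def)
  qed
  have "inj_on (\<lambda>x. H x / G x) W"
  proof (rule inj_onI)
    fix x y assume "x \<in> W" "y \<in> W" "H x / G x = H y / G y"
    then show "x = y" using inj'[of x y] inj'[of y x] by (metis linear)
  qed
  moreover have "finite W" using finV by (simp add: W_def)
  ultimately obtain r where r: "bij_betw r {..<card W} W"
    "\<And>i j. \<lbrakk>i < j; j < card W\<rbrakk> \<Longrightarrow> H (r i) / G (r i) < H (r j) / G (r j)"
    using bij_betw_strict_mono_key[of W "\<lambda>x. H x / G x"] by blast
  have cardW: "n = Suc (card W)"
    using n finV v by (metis V_def W_def card_Suc_Diff1)
  have rW: "r i \<in> W" if "i < card W" for i
    using bij_betwE[OF r(1)] that by blast
  have tri0: "tri v (r i) (r j) > 0" if "i < j" "j < card W" for i j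
    using that by (intro tri_v rW r(2)) auto
  \<comment> \<open>Otherwise the dependence of the four points would write \<open>r j\<close> as a
    convex combination of \<open>v\<close>, \<open>r i\<close> and \<open>r k\<close>.\<close>
  have tri1: "tri (r i) (r j) (r k) > 0" if ijk: "i < j" "j < k" "k < card W" for i j k
  proof (rule ccontr)
    assume neg: "\<not> tri (r i) (r j) (r k) > 0"
    define d where "d = tri v (r i) (r k)"
    have d: "d > 0" using ijk by (auto simp: d_def intro!: tri0)
    define \<alpha> \<beta> \<gamma> where "\<alpha> = - tri (r i) (r j) (r k) / d"
      and "\<beta> = tri v (r j) (r k) / d" and "\<gamma> = tri v (r i) (r j) / d"
    have "d *\<^sub>R r j = (- tri (r i) (r j) (r k)) *\<^sub>R v + tri v (r j) (r k) *\<^sub>R r i + tri v (r i) (r j) *\<^sub>R r k"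
      using tri_linear_relation[of "r i" "r j" "r k" v] by (simp add: d_def algebra_simps)
    then have "(1 / d) *\<^sub>R (d *\<^sub>R r j) = \<alpha> *\<^sub>R v + \<beta> *\<^sub>R r i + \<gamma> *\<^sub>R r k"
      by (simp add: \<alpha>_def \<beta>_def \<gamma>_def scaleR_add_right scaleR_diff_right)
    then have "r j = \<alpha> *\<^sub>R v + \<beta> *\<^sub>R r i + \<gamma> *\<^sub>R r k"
      using d by simp
    moreover have "\<alpha> \<ge> 0" "\<beta> \<ge> 0" "\<gamma> \<ge> 0"
      using neg d tri0[of j k] tri0[of i j] ijk by (auto simp: \<alpha>_def \<beta>_def \<gamma>_def field_simps)
    moreover have "\<alpha> + \<beta> + \<gamma> = 1"
      using tri_sum[of "r i" "r j" "r k" v] d by (simp add: \<alpha>_def \<beta>_def \<gamma>_def d_def field_simps)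
    ultimately have "r j \<in> convex hull {v, r i, r k}"
      unfolding convex_hull_3 by blast
    also have "\<dots> \<subseteq> convex hull (V - {r j})"
    proof (intro hull_mono)
      have "r i \<noteq> r j" "r k \<noteq> r j"
        using r(2)[of i j] r(2)[of j k] ijk by auto
      then show "{v, r i, r k} \<subseteq> V - {r j}"
        using v rW[of i] rW[of j] rW[of k] ijk by (auto simp: W_def)
    qed
    finally show False using hull[of "r j"] rW[of j] ijk by (auto simp: W_def)
  qed
  define r' where "r' i = (case i of 0 \<Rightarrow> v | Suc i \<Rightarrow> r i)" for i
  have "tri (r' i) (r' j) (r' k) > 0" if "i < j" "j < k" "k < n" for i j k
    using that cardW by (auto simp: r'_def split: nat.splits intro: tri0 tri1)
  then have "convex_cycle n (\<lambda>i. r' (i mod n))"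
    by (rule convex_cycle_mod)
  moreover have "range (\<lambda>i. r' (i mod n)) = V"
  proof -
    have "range (\<lambda>i. r' (i mod n)) = r' ` {..<n}"
    proof (intro equalityI subsetI)
      fix x assume "x \<in> r' ` {..<n}"
      then obtain i where "i < n" "x = r' (i mod n)" by force
      then show "x \<in> range (\<lambda>i. r' (i mod n))" by blast
    qed (use \<open>n > 0\<close> in auto)
    also have "\<dots> = insert v (r ` {..<card W})"
      by (simp add: cardW lessThan_Suc_eq_insert_0 image_image r'_def)
    also have "\<dots> = V"
      using r(1) v by (auto simp: bij_betw_def W_def)
    finally show ?thesis .
  qed
  ultimately show ?thesis using that by (simp add: V_def)
qed

section \<open>Choice of the starting vertex\<close>

lemma prod_periodic_shift:
  fixes f :: "nat \<Rightarrow> 'a::comm_monoid_mult"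
  assumes "\<And>i. f (i + n) = f i"
  shows "(\<Prod>i<n. f (i + m)) = (\<Prod>i<n. f i)"
proof (induction m)
  case (Suc m)
  have "(\<Prod>i<n. f (i + Suc m)) = (\<Prod>i<n. f (i + m))"
  proof (cases n)
    case (Suc n')
    have "(\<Prod>i<n. f (i + m)) = f m * (\<Prod>i<n'. f (i + Suc m))"
      unfolding Suc by (subst prod.lessThan_Suc_shift) simp
    also have "f m = f (n' + Suc m)"
      using assms[of m] Suc by (simp add: add.commute)
    finally show ?thesis unfolding Suc by (simp add: mult.commute)
  qed simp
  with Suc show ?case by simp
qed simp

lemma heptagon_good_index:
  fixes q :: "nat \<Rightarrow> real ^ 2"
  assumes q: "convex_cycle 7 q"
  defines "T \<equiv> \<lambda>i j k. tri (q i) (q j) (q k)"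
  shows "\<exists>s. T s (s+1) (s+2) * T (s+4) (s+5) (s+6) \<le> T (s+5) (s+6) (s+7) * T (s+1) (s+2) (s+4) \<and>
             T (s+1) (s+2) (s+3) * T (s+5) (s+6) (s+7) \<le> T s (s+1) (s+2) * T (s+3) (s+5) (s+6)"
proof -
  have per: "q (i + 7) = q i" for i
    using q by (simp add: convex_cycle_def)
  have pos: "T i j k > 0" if "i < j" "j < k" "k < i + 7" for i j k
    using q that by (simp add: convex_cycle_def T_def)
  define t where "t i = T i (i+1) (i+2)" for i
  define a where "a i = T i (i+1) (i+3)" for i
  define b where "b i = T i (i+2) (i+3)" for i
  have per': "t (i + 7) = t i" "a (i + 7) = a i" "b (i + 7) = b i" for i
    using per[of i] per[of "i+1"] per[of "i+2"] per[of "i+3"]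
    by (simp_all add: t_def a_def b_def T_def add.commute add.left_commute)
  have t: "t i > 0" and a: "a i > 0" and b: "b i > 0" for i
    by (auto simp: t_def a_def b_def intro!: pos)
  \<comment> \<open>\<open>ab\<close>, \<open>aa\<close> and \<open>bb\<close> are Pluecker
    relations with one positive product dropped.\<close>
  have ab: "t i * t (i+2) < a (i+1) * b i" for i
  proof -
    have "a (i+1) * b i = t i * t (i+2) + t (i+1) * T i (i+2) (i+4)"
      using tri_pluecker[of "q (i+2)" "q (i+3)" "q i" "q (i+4)" "q (i+1)"]
      by (simp add: t_def a_def b_def T_def tri_rotate numeral_eq_Suc mult.commute)
    moreover have "t (i+1) * T i (i+2) (i+4) > 0"
      by (intro mult_pos_pos t pos) auto
    ultimately show ?thesis by simp
  qed
  have aa: "t i * b (i+1) < a i * a (i+1)" for i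
  proof -
    have "a i * a (i+1) = t i * b (i+1) + t (i+1) * T i (i+1) (i+4)"
      using tri_pluecker[of "q (i+1)" "q (i+2)" "q (i+4)" "q (i+3)" "q i"]
      by (simp add: t_def a_def b_def T_def tri_rotate numeral_eq_Suc mult.commute)
    moreover have "t (i+1) * T i (i+1) (i+4) > 0"
      by (intro mult_pos_pos t pos) auto
    ultimately show ?thesis by simp
  qed
  have bb: "t (i+2) * a i < b i * b (i+1)" for i
  proof -
    have "b i * b (i+1) = t (i+2) * a i + t (i+1) * T i (i+3) (i+4)"
      using tri_pluecker[of "q (i+3)" "q (i+4)" "q (i+1)" "q i" "q (i+2)"]
      by (simp add: t_def a_def b_def T_def tri_rotate numeral_eq_Suc mult.commute)
    moreover have "t (i+1) * T i (i+3) (i+4) > 0"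
      by (intro mult_pos_pos t pos) auto
    ultimately show ?thesis by simp
  qed
  define X where "X s \<longleftrightarrow> t s * t (s+4) \<le> t (s+5) * a (s+1)" for s
  define Y where "Y s \<longleftrightarrow> t (s+1) * t (s+5) \<le> t s * b (s+3)" for s
  have "\<exists>s. X s \<and> Y s"
  proof (rule ccontr)
    assume none: "\<nexists>s. X s \<and> Y s"
    \<comment> \<open>By \<open>XY\<close>, stepping by \<open>4\<close> modulo \<open>7\<close>, either \<open>X\<close> fails everywhere or \<open>Y\<close> does; the products
      over all indices then contradict \<open>ab\<close> and one of \<open>aa\<close>, \<open>bb\<close>.\<close>
    have XY: "X s \<or> Y (s+4)" for s
    proof (rule ccontr)
      assume "\<not> (X s \<or> Y (s+4))"
      \<comment> \<open>By periodicity \<open>s + 9\<close> and \<open>s + 7\<close> become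
        \<open>s + 2\<close> and \<open>s\<close>; multiplying the two failures and cancelling
        contradicts \<open>ab\<close>.\<close>
      then have *: "t (s+5) * a (s+1) < t s * t (s+4)" "t (s+4) * b s < t (s+5) * t (s+2)"
        using per'(3)[of s] per'(1)[of "s+2"] by (auto simp: X_def Y_def add.commute)
      have "(t (s+5) * a (s+1)) * (t (s+4) * b s) < (t s * t (s+4)) * (t (s+5) * t (s+2))"
        by (intro mult_strict_mono * mult_nonneg_nonneg mult_pos_pos less_imp_le t a b)
      then have "(t (s+4) * t (s+5)) * (a (s+1) * b s) < (t (s+4) * t (s+5)) * (t s * t (s+2))"
        by (simp add: mult_ac)
      then show False using ab[of s] t[of "s+4"] t[of "s+5"]
        by (smt (verit) mult_pos_pos mult_less_cancel_left_pos)
    qed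
    define \<tau> \<alpha> \<beta> where "\<tau> = (\<Prod>i<7. t i)" and "\<alpha> = (\<Prod>i<7. a i)" and "\<beta> = (\<Prod>i<7. b i)"
    note defs = \<tau>_def \<alpha>_def \<beta>_def
    have pt: "(\<Prod>i<7. t (i+m)) = \<tau>" and pa: "(\<Prod>i<7. a (i+m)) = \<alpha>" and pb: "(\<Prod>i<7. b (i+m)) = \<beta>" for m
      unfolding defs by (intro prod_periodic_shift per')+
    have gt0: "\<tau> > 0" "\<alpha> > 0" "\<beta> > 0"
      unfolding defs by (intro prod_pos ballI t a b)+
    have prod_less: "(\<Prod>i<7. f i * g i) < (\<Prod>i<7. f' i * g' i)"
      if "\<And>i. f i * g i < f' i * g' i" "\<And>i. f i > 0" "\<And>i. g i > 0" for f g f' g' :: "nat \<Rightarrow> real"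
    proof (rule prod_mono_strict[of 0])
      fix i show "0 \<le> f i * g i \<and> f i * g i \<le> f' i * g' i"
        using that by (simp add: less_imp_le)
      show "0 < f' i * g' i"
        using that by (metis less_trans mult_pos_pos)
    qed (use that in auto)
    have AB: "\<tau> * \<tau> < \<alpha> * \<beta>"
      using prod_less[of t "\<lambda>i. t (i+2)" "\<lambda>i. a (i+1)" b, OF ab t t] by (simp only: prod.distrib pt pa pb flip: defs)
    have AA: "\<tau> * \<beta> < \<alpha> * \<alpha>"
      using prod_less[of t "\<lambda>i. b (i+1)" a "\<lambda>i. a (i+1)", OF aa t b] by (simp only: prod.distrib pt pa pb flip: defs)
    have BB: "\<tau> * \<alpha> < \<beta> * \<beta>"
      using prod_less[of "\<lambda>i. t (i+2)" a b "\<lambda>i. b (i+1)", OF bb t a] by (simp only: prod.distrib pt pa pb flip: defs)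
    \<comment> \<open>For \<open>z = \<tau>\<close>, the failure of one condition everywhere gives
      \<open>x < z\<close>; then \<open>AA\<close> or \<open>BB\<close> gives \<open>y < z\<close>,
      against \<open>AB\<close>.\<close>
    have contr: False if "x > 0" "y > 0" "z > 0" "z * x < z * z" "z * y < x * x" "z * z < x * y" for x y z :: real
    proof -
      have "x < z" using that by simp
      then have "z * y < z * z"
        using that by (smt (verit) mult_strict_mono)
      then have "y < z" using that by simp
      then show False using \<open>x < z\<close> that by (smt (verit) mult_strict_mono)
    qed
    show False
    proof (cases "\<forall>s. \<not> X s")
      case True
      then have "t (i+5) * a (i+1) < t i * t (i+4)" for i
        by (simp add: X_def not_le)
      from prod_less[of "\<lambda>i. t (i+5)" "\<lambda>i. a (i+1)" t "\<lambda>i. t (i+4)", OF this t a] have "\<tau> * \<alpha> < \<tau> * \<tau>"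
        by (simp only: prod.distrib pt pa flip: defs)
      then show False using contr[of \<alpha> \<beta> \<tau>] gt0 AA AB by simp
    next
      case False
      then obtain s0 where s0: "X s0" by blast
      have perX: "X (s + 7 * m) \<longleftrightarrow> X s" for s m
      proof (induction m)
        case (Suc m)
        have "X (s + 7 * Suc m) \<longleftrightarrow> X ((s + 7 * m) + 7)" by (simp add: add.commute add.left_commute)
        also have "\<dots> \<longleftrightarrow> X (s + 7 * m)"
          using per'(1)[of "s + 7*m"] per'(1)[of "s + 7*m + 4"] per'(1)[of "s + 7*m + 5"] per'(2)[of "s + 7*m + 1"]
          by (simp add: X_def add.commute add.left_commute)
        finally show ?case using Suc by simp
      qed simp
      have step: "X (s + 3)" if "X s" for s
      proof (rule ccontr)
        assume "\<not> X (s + 3)"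
        then have "Y (s + 7)" using XY[of "s+3"] by (simp add: add.assoc)
        then show False using none perX[of s 1] that by auto
      qed
      have steps: "X (s0 + 3 * k)" for k
      proof (induction k)
        case (Suc k)
        then show ?case using step[of "s0 + 3 * k"] by (simp add: add.commute add.left_commute)
      qed (simp add: s0)
      have "X s" for s
      proof -
        \<comment> \<open>Modulo \<open>7\<close>, \<open>5\<close> inverts \<open>3\<close> and
          \<open>6 * s0\<close> stands for \<open>- s0\<close>, so this many steps lead from
          \<open>s0\<close> to \<open>s\<close>.\<close>
        have "s0 + 3 * (5 * (s + 6 * s0)) = s + 7 * (13 * s0 + 2 * s)" by simp
        then show ?thesis using steps[of "5 * (s + 6 * s0)"] perX by metis
      qed
      then have "t i * b (i+3) < t (i+1) * t (i+5)" for i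
        using none by (auto simp: Y_def not_le)
      from prod_less[of t "\<lambda>i. b (i+3)" "\<lambda>i. t (i+1)" "\<lambda>i. t (i+5)", OF this t b] have "\<tau> * \<beta> < \<tau> * \<tau>"
        by (simp only: prod.distrib pt pb flip: defs)
      then show False using contr[of \<beta> \<alpha> \<tau>] gt0 BB AB by (simp add: mult.commute)
    qed
  qed
  then obtain s where "X s" "Y s" by blast
  moreover have "s + 1 + 1 = s + 2" "s + 1 + 2 = s + 3" "s + 1 + 3 = s + 4" "s + 4 + 1 = s + 5" "s + 4 + 2 = s + 6"
    "s + 5 + 1 = s + 6" "s + 5 + 2 = s + 7" "s + 3 + 2 = s + 5" "s + 3 + 3 = s + 6"
    by simp_all
  ultimately show ?thesis
    unfolding X_def Y_def t_def a_def b_def by (intro exI[of _ s]) metis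
qed

section \<open>The factorization for a heptagon\<close>

text \<open>Eliminating \<open>L3\<close> turns \<open>e\<close> times the expression into a
  combination of \<open>L4\<close>, \<open>L2\<close>, \<open>L1\<close> with nonnegative
  coefficients \<open>g * e - c * d\<close>, \<open>\<alpha> * e - c * m\<close> and
  \<open>c * n\<close>.\<close>

lemma quadruple_combination_nonneg:
  fixes L1 L2 L3 L4 :: real
  assumes "e * L3 = m * L2 + d * L4 - n * L1"
    and "e > 0" "c \<ge> 0" "n \<ge> 0" "c * d \<le> g * e" "c * m \<le> \<alpha> * e"
    and "L1 \<ge> 0" "L2 \<ge> 0" "L4 \<ge> 0"
  shows "g * L4 + \<alpha> * L2 - c * L3 \<ge> 0"
proof -
  have "e * (g * L4 + \<alpha> * L2 - c * L3) = (g * e) * L4 + (\<alpha> * e) * L2 - c * (e * L3)"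
    by (simp add: algebra_simps)
  also have "\<dots> = (g * e - c * d) * L4 + (\<alpha> * e - c * m) * L2 + c * n * L1"
    unfolding assms(1) by (simp add: algebra_simps)
  also have "\<dots> \<ge> 0"
    using assms by simp
  finally show ?thesis
    using \<open>e > 0\<close> by (simp add: zero_le_mult_iff)
qed

lemma nonneg_factorization_heptagon:
  fixes q p :: "nat \<Rightarrow> real ^ 2" and c :: "nat \<Rightarrow> real ^ 2 \<Rightarrow> real"
  assumes q: "convex_cycle 7 q"
    and lin: "\<And>i. i < f \<Longrightarrow> linear (c i)"
    and nonneg: "\<And>i k. i < f \<Longrightarrow> c i (q k) \<ge> \<beta> i"
    and p: "\<And>t. t < v \<Longrightarrow> p t \<in> range q"
  shows "nonneg_factorization (Matrix.mat f v (\<lambda>(i, t). c i (p t) - \<beta> i)) 6"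
proof -
  define T0 where "T0 i j k = tri (q i) (q j) (q k)" for i j k
  obtain s where s:
    "T0 s (s+1) (s+2) * T0 (s+4) (s+5) (s+6) \<le> T0 (s+5) (s+6) (s+7) * T0 (s+1) (s+2) (s+4)"
    "T0 (s+1) (s+2) (s+3) * T0 (s+5) (s+6) (s+7) \<le> T0 s (s+1) (s+2) * T0 (s+3) (s+5) (s+6)"
    using heptagon_good_index[OF q] unfolding T0_def by blast
  define z where "z i = q (i + s)" for i
  have z: "convex_cycle 7 z"
    unfolding z_def using q by (rule convex_cycle_shift)
  define T where "T i j k = tri (z i) (z j) (z k)" for i j k
  have X: "T 0 1 2 * T 4 5 6 \<le> T 5 6 7 * T 1 2 4"
    and Y: "T 1 2 3 * T 5 6 7 \<le> T 0 1 2 * T 3 5 6"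
    using s by (simp_all add: T0_def T_def z_def add.commute)
  have pos: "T i j k > 0" if "i < j" "j < k" "k < i + 7" for i j k
    using z that by (simp add: convex_cycle_def T_def)
  have z7: "z 7 = z 0"
    using z unfolding convex_cycle_def by (metis add_0)
  \<comment> \<open>Coefficients of the dependences normalized to give \<open>z 0\<close>
    coefficient 1; the primed ones come from the reflection of \<open>k\<close> to
    \<open>7 - k\<close>, with \<open>z 7 = z 0\<close>.\<close>
  define a b g where "a = T 0 1 3 / T 1 2 3" and "b = T 0 2 3 / T 1 2 3" and "g = T 0 1 2 / T 1 2 3"
  define a' b' g' where "a' = T 4 6 7 / T 4 5 6" and "b' = T 4 5 7 / T 4 5 6" and "g' = T 5 6 7 / T 4 5 6"
  note coeff_defs = a_def b_def g_def a'_def b'_def g'_def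
  have coeffs: "a > 0" "b > 0" "g > 0" "a' > 0" "b' > 0" "g' > 0"
    unfolding coeff_defs by (auto intro!: divide_pos_pos pos)
  define L where "L i k = c i (z k) - \<beta> i" for i k
  have L: "L i k \<ge> 0" if "i < f" for i k
    using nonneg[OF that] by (simp add: L_def z_def)
  have rel: "T k l m * L i j + T j k m * L i l = T j l m * L i k + T j k l * L i m" if "i < f" for i j k l m
    unfolding T_def L_def using lin[OF that] by (rule tri_affine_relation)
  have rel0: "L i 0 + a * L i 2 = b * L i 1 + g * L i 3" if "i < f" for i
    using rel[OF that, of 1 2 3 0] pos[of 1 2 3] by (simp add: coeff_defs field_simps)
  have rel0': "L i 0 + a' * L i 5 = b' * L i 6 + g' * L i 4" if "i < f" for i
  proof -
    have "L i 7 = L i 0" by (simp add: L_def z7)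
    then show ?thesis
      using rel[OF that, of 5 6 7 4] pos[of 4 5 6] by (simp add: coeff_defs field_simps)
  qed
  \<comment> \<open>The vector \<open>g' z4 - z0 + b z1\<close> lies in the cone of \<open>z1\<close>, \<open>z2\<close>, \<open>z4\<close> exactly when \<open>X\<close> holds;
    \<open>Y_nonneg\<close> is the mirror image.\<close>
  have X_nonneg: "g' * L i 4 - L i 0 + b * L i 1 \<ge> 0" if "i < f" for i
  proof -
    have "g' * L i 4 + a * L i 2 - g * L i 3 \<ge> 0"
    proof (rule quadruple_combination_nonneg)
      show "T 1 2 4 * L i 3 = T 1 3 4 * L i 2 + T 1 2 3 * L i 4 - T 2 3 4 * L i 1"
        using rel[OF that, of 2 3 4 1] by simp
      \<comment> \<open>\<open>X\<close> is the condition on the coefficient of \<open>z 4\<close>;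
        the one on \<open>z 2\<close> follows from a Pluecker relation.\<close>
      show "g * T 1 2 3 \<le> g' * T 1 2 4"
        using X pos[of 1 2 3] pos[of 4 5 6] by (simp add: coeff_defs field_simps)
      have "T 1 2 4 * T 0 1 3 = T 1 2 3 * T 0 1 4 + T 0 1 2 * T 1 3 4"
        using tri_pluecker[of "z 1" "z 2" "z 4" "z 3" "z 0"] by (simp add: T_def tri_rotate)
      then have "T 0 1 2 * T 1 3 4 \<le> T 0 1 3 * T 1 2 4"
        using pos[of 1 2 3] pos[of 0 1 4] by (simp add: mult.commute)
      then show "g * T 1 3 4 \<le> a * T 1 2 4"
        using pos[of 1 2 3] by (simp add: coeff_defs field_simps)
    qed (use coeffs L[OF that] pos in \<open>auto simp: less_imp_le\<close>)
    then show ?thesis using rel0[OF that] by simp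
  qed
  have Y_nonneg: "g * L i 3 - L i 0 + b' * L i 6 \<ge> 0" if "i < f" for i
  proof -
    have "g * L i 3 + a' * L i 5 - g' * L i 4 \<ge> 0"
    proof (rule quadruple_combination_nonneg)
      show "T 3 5 6 * L i 4 = T 3 4 6 * L i 5 + T 4 5 6 * L i 3 - T 3 4 5 * L i 6"
        using rel[OF that, of 4 5 6 3] by simp
      show "g' * T 4 5 6 \<le> g * T 3 5 6"
        using Y pos[of 1 2 3] pos[of 4 5 6] by (simp add: coeff_defs field_simps)
      have "T 4 6 7 * T 3 5 6 = T 3 6 7 * T 4 5 6 + T 5 6 7 * T 3 4 6"
        using tri_pluecker[of "z 6" "z 7" "z 4" "z 3" "z 5"] by (simp add: T_def tri_rotate)
      then have "T 5 6 7 * T 3 4 6 \<le> T 4 6 7 * T 3 5 6"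
        using pos[of 3 6 7] pos[of 4 5 6] by simp
      then show "g' * T 3 4 6 \<le> a' * T 3 5 6"
        using pos[of 4 5 6] by (simp add: coeff_defs field_simps)
    qed (use coeffs L[OF that] pos in \<open>auto simp: less_imp_le\<close>)
    then show ?thesis using rel0'[OF that] by simp
  qed
  \<comment> \<open>In vector form \<open>x\<close> reads \<open>(g' z4 - z0, 0, g z3 - z0)\<close> and \<open>y\<close> reads \<open>(b' z6, z0, b z1)\<close>.
    By the two relations \<open>rel0\<close>, seven of the nine sums \<open>x r + y s\<close> are positive multiples of
    the seven vertices; the other two are the vectors of \<open>X_nonneg\<close> and \<open>Y_nonneg\<close>.\<close>
  define x where "x i r = (if r = 0 then g' * L i 4 - L i 0 else if r = 1 then 0 else g * L i 3 - L i 0)"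
    for i and r :: nat
  define y where "y i r = (if r = 0 then b' * L i 6 else if r = 1 then L i 0 else b * L i 1)"
    for i and r :: nat
  let ?S = "Matrix.mat f v (\<lambda>(i, t). c i (p t) - \<beta> i)"
  have "nonneg_factorization ?S (3 + 3)"
  proof (rule nonneg_factorization_of_sum_grid)
    fix i r s :: nat
    assume "i < dim_row ?S" and rs: "r < 3" "s < 3"
    then have i: "i < f" by simp
    have "r = 0 \<or> r = 1 \<or> r = 2" "s = 0 \<or> s = 1 \<or> s = 2" using rs by auto
    moreover have "g' * L i 4 - L i 0 + b' * L i 6 \<ge> 0"
      using rel0'[OF i] mult_nonneg_nonneg[OF less_imp_le[OF coeffs(4)] L[OF i, of 5]] by linarith
    moreover have "g * L i 3 - L i 0 + b * L i 1 \<ge> 0"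
      using rel0[OF i] mult_nonneg_nonneg[OF less_imp_le[OF coeffs(1)] L[OF i, of 2]] by linarith
    ultimately show "x i r + y i s \<ge> 0"
      using X_nonneg[OF i] Y_nonneg[OF i] coeffs L[OF i]
      by (elim disjE) (simp_all add: x_def y_def)
  next
    fix t assume "t < dim_col ?S"
    then have t: "t < v" by simp
    obtain k where k: "p t = q k" using p[OF t] by blast
    obtain j where "j < 7" and j: "p t = z j"
      using convex_cycle_shift_surj[OF q, of k s] k by (auto simp: z_def)
    \<comment> \<open>\<open>w\<close> scales the vertex up to the sum, so the weight in the
      factorization is \<open>1 / w\<close>.\<close>
    have entry: "\<exists>r<3. \<exists>s<3. \<exists>w\<ge>0. \<forall>i<dim_row ?S. ?S $$ (i, t) = w * (x i r + y i s)"
      if "r < 3" "s < 3" "w > 0" "\<And>i. i < f \<Longrightarrow> w * L i j = x i r + y i s" for r s w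
    proof -
      have "?S $$ (i, t) = (1 / w) * (x i r + y i s)" if "i < f" for i
        using that t \<open>w > 0\<close> \<open>\<And>i. i < f \<Longrightarrow> w * L i j = x i r + y i s\<close>[OF that, symmetric]
        by (simp add: L_def j)
      then show ?thesis
        using \<open>r < 3\<close> \<open>s < 3\<close> \<open>w > 0\<close>
        by (intro exI[of _ r] exI[of _ s] exI[of _ "1 / w"] conjI) simp_all
    qed
    from \<open>j < 7\<close> consider "j = 0" | "j = 1" | "j = 2" | "j = 3" | "j = 4" | "j = 5" | "j = 6" by linarith
    then show "\<exists>r<3. \<exists>s<3. \<exists>w\<ge>0. \<forall>i<dim_row ?S. ?S $$ (i, t) = w * (x i r + y i s)"
    proof cases
      case 1 show ?thesis by (rule entry[of 1 1 1]) (simp_all add: x_def y_def 1)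
    next
      case 2 show ?thesis by (rule entry[of 1 2 b]) (simp_all add: x_def y_def 2 coeffs)
    next
      case 3 show ?thesis by (rule entry[of 2 2 a]) (use rel0 in \<open>force simp add: x_def y_def 3 coeffs\<close>)+
    next
      case 4 show ?thesis by (rule entry[of 2 1 g]) (simp_all add: x_def y_def 4 coeffs)
    next
      case 5 show ?thesis by (rule entry[of 0 1 g']) (simp_all add: x_def y_def 5 coeffs)
    next
      case 6 show ?thesis by (rule entry[of 0 0 a']) (use rel0' in \<open>force simp add: x_def y_def 6 coeffs\<close>)+
    next
      case 7 show ?thesis by (rule entry[of 1 0 b']) (simp_all add: x_def y_def 7 coeffs)
    qed
  qed simp
  then show ?thesis by simp
qed

section \<open>The bound on the nonnegative rank\<close>

theorem theorem2p13:
  fixes P :: "(real ^ 2) set" and S :: "real mat"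
  assumes "convex_heptagon P"
    and "slack_matrix_of S P"
  shows "nonneg_rank S \<le> 6"
proof -
  obtain q where q: "convex_cycle 7 q" "range q = {x. x extreme_point_of P}"
    using assms(1) polytope_vertices_convex_cycle[of P 7] unfolding convex_heptagon_def by auto
  have qP: "q k \<in> P" for k
    using q(2) by (auto simp: extreme_point_of_def)
  obtain v f m p c \<beta> where fm: "f \<le> m" and lin: "\<forall>i<m. linear (c i)"
    and P: "P = {x. (\<forall>i<f. c i x \<ge> \<beta> i) \<and> (\<forall>j. f \<le> j \<and> j < m \<longrightarrow> c j x = \<beta> j)}"
    and p: "bij_betw p {..<v} {x. x extreme_point_of P}"
    and S: "S = Matrix.mat f v (\<lambda>(i, t). c i (p t) - \<beta> i)"
    using assms(2) unfolding slack_matrix_of_def by (elim conjE exE)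
  have "nonneg_factorization S 6"
    unfolding S
  proof (rule nonneg_factorization_heptagon[OF q(1)])
    show "linear (c i)" if "i < f" for i using lin fm that by simp
    show "c i (q k) \<ge> \<beta> i" if "i < f" for i k using qP[of k] that P by blast
    show "p t \<in> range q" if "t < v" for t using bij_betwE[OF p] that q(2) by blast
  qed
  then show ?thesis
    unfolding nonneg_rank_def by (rule Least_le)
qed

end
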